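(* Let $r = 2^{-1/2}$ and $B_r(0) = \{z \in \mathbb{C} : |z| < r\}$. The initial value problem $$s' = c\,(1+s^2), \quad c' = -s\,(1+c^2); \qquad s(0) = 0, \quad c(0) = 1$$ has a unique solution in $B_r(0)$; that is, there is exactly one pair $(s,c)$ of holomorphic functions $s, c : B_r(0) \to \mathbb{C}$ satisfying these equations throughout $B_r(0)$ and these initial conditions.
   Context: Primes denote complex derivatives. *)

theory Defs
  imports "HOL-Analysis.Analysis"
begin

definition is_solution_on :: "complex set \<Rightarrow> (complex \<Rightarrow> complex) \<Rightarrow> (complex \<Rightarrow> complex) \<Rightarrow> bool" where
  "is_solution_on U s c \<longleftrightarrow>
     s holomorphic_on U \<and> c holomorphic_on U \<and>
     (\<forall>z\<in>U. deriv s z = c z * (1 + (s z)\<^sup>2)) \<and>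
     (\<forall>z\<in>U. deriv c z = - s z * (1 + (c z)\<^sup>2)) \<and>
     s 0 = 0 \<and> c 0 = 1"

end

theory Submission
  imports Defs "HOL-Complex_Analysis.Conformal_Mappings"
begin

text \<open>
  Every solution satisfies \<open>(1 + s\<^sup>2) * (1 + c\<^sup>2) = 2\<close>: the equations make the derivative of the left-hand
  side vanish. Eliminating \<open>c\<close> turns the system into \<open>(s')\<^sup>2 = 1 - s ^ 4\<close>, the equation of
  the lemniscatic sine. Near \<open>0\<close> the initial conditions select the principal root,
  \<open>s' = csqrt (1 - s ^ 4)\<close>, and hence \<open>F (s z) = z\<close>, where \<open>F\<close> is the primitive of
  \<open>1 / csqrt (1 - t ^ 4)\<close> on the unit disc with \<open>F 0 = 0\<close>. Both existence and uniqueness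
  are therefore statements about the inverse of \<open>F\<close>.

  The radius \<open>1 / sqrt 2\<close> comes from the bound \<open>\<bar>csqrt (1 - t ^ 4)\<bar> \<le> sqrt 2\<close> in its sharper
  form \<open>Re (1 / csqrt (1 - t ^ 4)) \<ge> 1 / sqrt 2\<close> (\<open>Re_inverse_ge_of_square_near_1\<close>). By the mean
  value theorem along segments, \<open>F\<close> expands distances by at least this factor
  (\<open>norm_diff_ge_of_Re_deriv_ge\<close>). So \<open>F\<close> is injective, and the image of the unit disc contains the disc of
  radius \<open>1 / sqrt 2\<close> (\<open>ball_subset_image_of_norm_diff_ge\<close>).

  Existence: take \<open>s\<close> to be the inverse of \<open>F\<close> and \<open>c = s' / (1 + s\<^sup>2)\<close>. Uniqueness: two
  solutions have \<open>F (s1 z) = z = F (s2 z)\<close> near \<open>0\<close>, so \<open>s1\<close> and \<open>s2\<close> agree there by injectivity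
  and on the whole disc by the identity theorem; the first equation then determines \<open>c\<close>,
  since \<open>1 + s\<^sup>2\<close> has no zero.
\<close>

section \<open>Holomorphic maps with derivative in a half-plane\<close>

text \<open>
  A quantitative form of the Noshiro-Warschawski criterion for univalence: on the segment
  from \<open>a\<close> to \<open>b\<close>, the real part of \<open>F / (b - a)\<close> has derivative \<open>Re f\<close>, which is at
  least \<open>m\<close>.
\<close>

lemma norm_diff_ge_of_Re_deriv_ge:
  fixes F :: "complex \<Rightarrow> complex"
  assumes S: "convex S" "a \<in> S" "b \<in> S"
    and F: "\<And>z. z \<in> S \<Longrightarrow> (F has_field_derivative f z) (at z)"
    and Re: "\<And>z. z \<in> S \<Longrightarrow> m \<le> Re (f z)"
  shows "m * cmod (b - a) \<le> cmod (F b - F a)"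
proof (cases "a = b")
  case False
  have "\<exists>u. u \<in> closed_segment a b \<and>
          Re (F b / (b - a)) - Re (F a / (b - a)) = Re (f u / (b - a) * (b - a))"
    using closed_segment_subset[OF S(2,3,1)]
    by (intro complex_mvt_line[where f = "\<lambda>z. F z / (b - a)"] DERIV_cdivide F) auto
  then obtain u where u: "u \<in> closed_segment a b" "Re ((F b - F a) / (b - a)) = Re (f u)"
    using False by (auto simp: diff_divide_distrib)
  have "m \<le> Re (f u)"
    using u(1) closed_segment_subset[OF S(2,3,1)] Re by blast
  also have "\<dots> \<le> cmod ((F b - F a) / (b - a))"
    unfolding u(2)[symmetric] by (rule complex_Re_le_cmod)
  finally show ?thesis
    using False by (simp add: norm_divide field_simps)
qed auto

text \<open>
  The lower bound sends the circle of radius \<open>\<rho>\<close> outside the open disc \<open>B\<close> of radius \<open>m * \<rho>\<close>. The part of the image of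
  the disc of radius \<open>\<rho>\<close> that lies in \<open>B\<close> is therefore both open (open mapping theorem) and
  closed in \<open>B\<close> (compactness), so it is all of \<open>B\<close>. Every \<open>\<rho> < R\<close> is allowed.
\<close>

lemma ball_subset_image_of_norm_diff_ge:
  fixes F :: "complex \<Rightarrow> complex"
  assumes hol: "F holomorphic_on ball 0 R" and F0: "F 0 = 0" and m: "m > 0"
    and inj: "inj_on F (ball 0 R)"
    and lower: "\<And>z. z \<in> ball 0 R \<Longrightarrow> m * cmod z \<le> cmod (F z)"
  shows "ball 0 (m * R) \<subseteq> F ` ball 0 R"
proof
  fix y :: complex assume "y \<in> ball 0 (m * R)"
  then have "cmod y / m < R" using m by (simp add: field_simps)
  then obtain \<rho> where \<rho>: "cmod y / m < \<rho>" "\<rho> < R" using dense by blast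
  have \<rho>0: "\<rho> > 0" using \<rho>(1) m by (meson divide_nonneg_pos le_less_trans norm_ge_zero)
  let ?B = "ball 0 (m * \<rho>) :: complex set"
  let ?T = "?B \<inter> F ` ball 0 \<rho>"
  have sub: "ball 0 \<rho> \<subseteq> ball 0 R" "cball 0 \<rho> \<subseteq> ball (0::complex) R" using \<rho> by auto
  have "open (F ` ball 0 \<rho>)"
    using open_mapping_thm3 hol inj sub(1) holomorphic_on_subset inj_on_subset by (metis open_ball)
  then have "openin (top_of_set ?B) ?T" by (simp add: openin_open_Int)
  \<comment> \<open>No boundary point of the smaller disc is mapped into \<open>?B\<close>, so its image there is also that of a compact set.\<close>
  moreover have "?T = ?B \<inter> F ` cball 0 \<rho>"
  proof -
    have "z \<in> ball 0 \<rho>" if "z \<in> cball 0 \<rho>" "F z \<in> ?B" for z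
    proof -
      have "m * cmod z < m * \<rho>" using lower[of z] that sub(2) by auto
      then show ?thesis using m by simp
    qed
    then show ?thesis by auto
  qed
  moreover have "compact (F ` cball 0 \<rho>)"
    using hol sub(2) by (meson compact_cball compact_continuous_image continuous_on_subset
        holomorphic_on_imp_continuous_on)
  ultimately have "closedin (top_of_set ?B) ?T"
    by (simp add: closedin_closed_Int compact_imp_closed)
  with \<open>openin (top_of_set ?B) ?T\<close> have "?T = {} \<or> ?T = ?B"
    using connected_clopen[of ?B] by blast
  moreover have "0 \<in> ?T" using F0 \<rho>0 m by (auto intro!: image_eqI[of _ _ 0])
  ultimately have "?T = ?B" by blast
  moreover have "y \<in> ?B" using \<rho>(1) m by (simp add: field_simps)
  ultimately show "y \<in> F ` ball 0 R" using sub(1) by blast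
qed

section \<open>The lemniscatic integral\<close>

lemma Re_gt_0_of_dist_1:
  assumes "cmod (p - 1) < 1"
  shows "Re p > 0"
  using assms abs_Re_le_cmod[of "p - 1"] by simp

lemma one_minus_pow4_right_half_plane:
  fixes z :: complex
  assumes "z \<in> ball 0 1"
  shows "cmod ((1 - z ^ 4) - 1) < 1" "1 - z ^ 4 \<notin> \<real>\<^sub>\<le>\<^sub>0"
    "Re (csqrt (1 - z ^ 4)) > 0"
proof -
  show *: "cmod ((1 - z ^ 4) - 1) < 1"
    using assms by (simp add: norm_power power_less_one_iff)
  then show n: "1 - z ^ 4 \<notin> \<real>\<^sub>\<le>\<^sub>0"
    using Re_gt_0_of_dist_1[OF *] unfolding complex_nonpos_Reals_iff by linarith
  have "0 < cmod (1 - z ^ 4) + Re (1 - z ^ 4)"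
    using Re_gt_0_of_dist_1[OF *] norm_ge_zero[of "1 - z ^ 4"] by linarith
  then show "Re (csqrt (1 - z ^ 4)) > 0" by simp
qed

text \<open>
  The source of the constant \<open>1 / sqrt 2\<close>. The condition \<open>\<bar>v\<^sup>2 - 1\<bar> < 1\<close> unfolds to
  \<open>\<bar>v\<bar> ^ 4 < 2 * Re (v\<^sup>2)\<close>, and \<open>Re (v\<^sup>2) \<le> (Re v)\<^sup>2\<close>; together they give \<open>\<bar>v\<bar>\<^sup>2 < sqrt 2 * Re v\<close>,
  while \<open>Re (1 / v) = Re v / \<bar>v\<bar>\<^sup>2\<close>.
\<close>

lemma Re_inverse_ge_of_square_near_1:
  assumes v: "Re v > 0" and v2: "cmod (v\<^sup>2 - 1) < 1"
  shows "1 / sqrt 2 \<le> Re (1 / v)"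
proof -
  have "(cmod (v\<^sup>2 - 1))\<^sup>2 < 1" using v2 by (simp add: power_less_one_iff)
  then have "((cmod v)\<^sup>2)\<^sup>2 < 2 * Re (v\<^sup>2)"
    by (simp add: cmod_power2) (simp add: power2_eq_square algebra_simps)
  also have "\<dots> \<le> 2 * (Re v)\<^sup>2" by (simp add: power2_eq_square)
  also have "\<dots> = (sqrt 2 * Re v)\<^sup>2" by (simp add: power_mult_distrib)
  finally have "(cmod v)\<^sup>2 < sqrt 2 * Re v"
    using v by (meson less_imp_le mult_nonneg_nonneg power_less_imp_less_base real_sqrt_ge_zero zero_le_numeral)
  then have "1 / sqrt 2 * (cmod v)\<^sup>2 \<le> Re v" by (simp add: field_simps)
  moreover have "(cmod v)\<^sup>2 > 0" using v by auto
  ultimately have "1 / sqrt 2 \<le> Re v / (cmod v)\<^sup>2" by (simp only: pos_le_divide_eq)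
  then show ?thesis by (simp add: Re_divide cmod_power2)
qed

text \<open>
  \<open>F\<close> is the lemniscatic integral from \<open>0\<close> to \<open>z\<close>, whose inverse is the lemniscatic sine.
  Its derivative has real part at least \<open>1 / sqrt 2\<close> on the unit disc, so both criteria of the
  previous section apply.
\<close>

lemma lemniscatic_integral:
  obtains F :: "complex \<Rightarrow> complex" where
    "F 0 = 0"
    "\<And>z. z \<in> ball 0 1 \<Longrightarrow> (F has_field_derivative 1 / csqrt (1 - z ^ 4)) (at z)"
    "inj_on F (ball 0 1)"
    "ball 0 (1 / sqrt 2) \<subseteq> F ` ball 0 1"
proof -
  let ?f = "\<lambda>z. 1 / csqrt (1 - z ^ 4)"
  have "?f holomorphic_on ball 0 1"
    using one_minus_pow4_right_half_plane(2) by (intro holomorphic_intros) fastforce+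
  then obtain G where G: "\<And>z. z \<in> ball 0 1 \<Longrightarrow> (G has_field_derivative ?f z) (at z within ball 0 1)"
    using holomorphic_convex_primitive'[of "ball 0 1" ?f] by auto
  define F where "F = (\<lambda>z. G z - G 0)"
  have F: "(F has_field_derivative ?f z) (at z)" if "z \<in> ball 0 1" for z
    using G[OF that] that unfolding F_def
    by (auto simp: at_within_open[OF that] intro!: derivative_eq_intros)
  have Re: "1 / sqrt 2 \<le> Re (?f z)" if "z \<in> ball 0 1" for z
    using one_minus_pow4_right_half_plane[OF that] by (intro Re_inverse_ge_of_square_near_1) auto
  have lower: "1 / sqrt 2 * cmod (b - a) \<le> cmod (F b - F a)"
    if "a \<in> ball 0 1" "b \<in> ball 0 1" for a b
    by (rule norm_diff_ge_of_Re_deriv_ge[OF _ that F Re]) auto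
  have inj: "inj_on F (ball 0 1)"
  proof (rule inj_onI)
    fix a b assume "a \<in> ball 0 1" "b \<in> ball 0 1" "F a = F b"
    with lower[of a b] have "cmod (b - a) \<le> 0" by (simp add: divide_simps)
    then show "a = b" by simp
  qed
  have F0: "F 0 = 0" by (simp add: F_def)
  have "F holomorphic_on ball 0 1"
    unfolding holomorphic_on_open[OF open_ball] using F by blast
  from ball_subset_image_of_norm_diff_ge[OF this F0 _ inj, of "1 / sqrt 2"] lower[of 0]
  have "ball 0 (1 / sqrt 2) \<subseteq> F ` ball 0 1" using F0 by auto
  from that[OF F0 F inj this] show thesis by blast
qed

section \<open>Solutions of the initial value problem\<close>

lemma is_solution_on_DERIV:
  assumes "is_solution_on U s c" "open U" "z \<in> U"
  shows "(s has_field_derivative c z * (1 + (s z)\<^sup>2)) (at z)"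
    "(c has_field_derivative - s z * (1 + (c z)\<^sup>2)) (at z)"
  using assms holomorphic_derivI[of s U z UNIV] holomorphic_derivI[of c U z UNIV]
  by (simp_all add: is_solution_on_def)

text \<open>
  The two summands of the derivative are \<open>2 * s * c * (1 + s\<^sup>2) * (1 + c\<^sup>2)\<close> and its negative.
\<close>

lemma is_solution_on_first_integral:
  assumes sol: "is_solution_on U s c" and U: "open U" "convex U" "0 \<in> U" and "z \<in> U"
  shows "(1 + (s z)\<^sup>2) * (1 + (c z)\<^sup>2) = 2"
proof -
  let ?E = "\<lambda>z. (1 + (s z)\<^sup>2) * (1 + (c z)\<^sup>2)"
  have "(?E has_field_derivative 0) (at x within U)" if "x \<in> U" for x
    by (rule has_field_derivative_at_within)
      (rule derivative_eq_intros is_solution_on_DERIV[OF sol U(1) that] refl | simp add: algebra_simps power2_eq_square)+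
  then obtain k where "\<forall>x\<in>U. ?E x = k"
    using has_field_derivative_zero_constant[OF U(2)] by blast
  then have "?E z = ?E 0" using U(3) \<open>z \<in> U\<close> by simp
  also have "\<dots> = 2" using sol by (simp add: is_solution_on_def)
  finally show ?thesis .
qed

lemma square_eq_one_minus_pow4:
  fixes s c :: complex
  assumes "(1 + s\<^sup>2) * (1 + c\<^sup>2) = 2"
  shows "(c * (1 + s\<^sup>2))\<^sup>2 = 1 - s ^ 4"
proof -
  have "(c * (1 + s\<^sup>2))\<^sup>2 = (1 + s\<^sup>2) * ((1 + s\<^sup>2) * (1 + c\<^sup>2)) - (1 + s\<^sup>2)\<^sup>2"
    by (simp add: power2_eq_square algebra_simps)
  also have "\<dots> = 1 - s ^ 4"
    unfolding assms by (simp add: power2_eq_square power4_eq_xxxx algebra_simps)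
  finally show ?thesis .
qed

text \<open>
  Separation of variables. By the first integral, \<open>s' = c * (1 + s\<^sup>2)\<close> is a square root of
  \<open>1 - s ^ 4\<close>. It equals \<open>1\<close> at \<open>0\<close>, so near \<open>0\<close> it has positive real part and is the principal
  root; then \<open>F (s z)\<close> has derivative \<open>1\<close>. An arbitrary solution need not map its whole domain into
  the unit disc, hence only a neighbourhood of \<open>0\<close>.
\<close>

lemma lemniscatic_integral_of_solution:
  assumes sol: "is_solution_on (ball 0 r) s c" and r: "r > 0"
    and F0: "F 0 = 0"
    and F: "\<And>z. z \<in> ball 0 1 \<Longrightarrow> (F has_field_derivative 1 / csqrt (1 - z ^ 4)) (at z)"
  shows "\<forall>\<^sub>F z in nhds 0. s z \<in> ball 0 1 \<and> F (s z) = z"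
proof -
  have init: "s 0 = 0" "c 0 = 1" using sol by (auto simp: is_solution_on_def)
  have r0: "(0::complex) \<in> ball 0 r" using r by simp
  have "isCont s 0" "isCont c 0"
    using is_solution_on_DERIV[OF sol open_ball r0] DERIV_isCont by blast+
  then have "((\<lambda>z. cmod (s z)) \<longlongrightarrow> cmod (s 0)) (nhds 0)"
    "((\<lambda>z. Re (c z * (1 + (s z)\<^sup>2))) \<longlongrightarrow> Re (c 0 * (1 + (s 0)\<^sup>2))) (nhds 0)"
    unfolding continuous_at tendsto_at_iff_tendsto_nhds by (intro tendsto_intros; simp)+
  from order_tendstoD(2)[OF this(1), of 1] order_tendstoD(1)[OF this(2), of 0]
  have "\<forall>\<^sub>F z in nhds 0. cmod (s z) < 1" "\<forall>\<^sub>F z in nhds 0. Re (c z * (1 + (s z)\<^sup>2)) > 0"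
    using init by simp_all
  moreover have "\<forall>\<^sub>F z in nhds 0. z \<in> ball 0 r"
    using r0 by (intro eventually_nhds_in_open) auto
  ultimately have "\<forall>\<^sub>F z in nhds 0. cmod (s z) < 1 \<and> Re (c z * (1 + (s z)\<^sup>2)) > 0 \<and> z \<in> ball 0 r"
    by eventually_elim auto
  then obtain \<delta> where \<delta>: "\<delta> > 0" and
    near: "\<And>z. z \<in> ball 0 \<delta> \<Longrightarrow> cmod (s z) < 1 \<and> Re (c z * (1 + (s z)\<^sup>2)) > 0 \<and> z \<in> ball 0 r"
    unfolding eventually_nhds_metric by (auto simp: dist_commute)
  have D: "((\<lambda>z. F (s z) - z) has_field_derivative 0) (at z within ball 0 \<delta>)"
    if "z \<in> ball 0 \<delta>" for z
  proof -
    have z: "cmod (s z) < 1" "Re (c z * (1 + (s z)\<^sup>2)) > 0" "z \<in> ball 0 r"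
      using near[OF that] by auto
    let ?v = "c z * (1 + (s z)\<^sup>2)"
    have "(1 + (s z)\<^sup>2) * (1 + (c z)\<^sup>2) = 2"
      using is_solution_on_first_integral[OF sol _ _ _ z(3)] r by simp
    then have "?v\<^sup>2 = 1 - s z ^ 4"
      by (rule square_eq_one_minus_pow4)
    then have v: "csqrt (1 - s z ^ 4) = ?v"
      using z(2) by (intro csqrt_unique) auto
    have "?v \<noteq> 0" using z(2) by force
    have "((\<lambda>z. F (s z)) has_field_derivative 1 / csqrt (1 - s z ^ 4) * ?v) (at z)"
      using z by (intro DERIV_chain2[OF F is_solution_on_DERIV(1)[OF sol]]) auto
    then have "((\<lambda>z. F (s z)) has_field_derivative 1) (at z)"
      unfolding v using \<open>?v \<noteq> 0\<close> by simp
    from DERIV_diff[OF this DERIV_ident] show ?thesis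
      by (auto intro: has_field_derivative_at_within)
  qed
  obtain k where k: "\<And>z. z \<in> ball 0 \<delta> \<Longrightarrow> F (s z) - z = k"
    using has_field_derivative_zero_constant[OF convex_ball D] by blast
  have "k = 0" using k[of 0] \<delta> F0 init by simp
  then have "s z \<in> ball 0 1 \<and> F (s z) = z" if "z \<in> ball 0 \<delta>" for z
    using k[OF that] near[OF that] by simp
  then show ?thesis
    unfolding eventually_nhds_metric using \<delta> by (auto simp: dist_commute)
qed

text \<open>
  The local relation \<open>F (s z) = z\<close> identifies \<open>s\<close> near \<open>0\<close>, and the identity theorem propagates this to the disc.
  The function \<open>c\<close> is recovered from \<open>s'\<close>, since the first integral rules out \<open>1 + s\<^sup>2 = 0\<close>.
\<close>

lemma is_solution_on_unique:
  assumes sol1: "is_solution_on (ball 0 r) s1 c1"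
    and sol2: "is_solution_on (ball 0 r) s2 c2"
    and z: "z \<in> ball 0 r"
  shows "s1 z = s2 z \<and> c1 z = c2 z"
proof -
  have r: "r > 0" using z by (auto intro: le_less_trans[OF norm_ge_zero])
  obtain F where F: "F 0 = 0"
      "\<And>z. z \<in> ball 0 1 \<Longrightarrow> (F has_field_derivative 1 / csqrt (1 - z ^ 4)) (at z)"
    and inj: "inj_on F (ball 0 1)" and "ball 0 (1 / sqrt 2) \<subseteq> F ` ball 0 1"
    using lemniscatic_integral by blast
  have "\<forall>\<^sub>F z in nhds 0. s1 z = s2 z"
  proof -
    have "\<forall>\<^sub>F z in nhds 0. s1 z \<in> ball 0 1 \<and> F (s1 z) = z"
      by (rule lemniscatic_integral_of_solution[OF sol1 r F])
    moreover have "\<forall>\<^sub>F z in nhds 0. s2 z \<in> ball 0 1 \<and> F (s2 z) = z"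
      by (rule lemniscatic_integral_of_solution[OF sol2 r F])
    ultimately show ?thesis
      by eventually_elim (metis inj inj_onD)
  qed
  then have "\<forall>\<^sub>F z in nhds 0. s1 z = s2 z \<and> z \<in> ball 0 r"
    using r by (intro eventually_conj eventually_nhds_in_open) auto
  then obtain V where V: "open V" "0 \<in> V" "\<And>z. z \<in> V \<Longrightarrow> s1 z = s2 z \<and> z \<in> ball 0 r"
    unfolding eventually_nhds by blast
  have eq: "s1 w = s2 w" if "w \<in> ball 0 r" for w
  proof (rule analytic_continuation_open[where f = s1 and g = s2 and s = V and s' = "ball 0 r"])
    show "s1 holomorphic_on ball 0 r" "s2 holomorphic_on ball 0 r"
      using sol1 sol2 by (auto simp: is_solution_on_def)
  qed (use V that in auto)
  have "deriv s1 z = deriv s2 z"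
    using eq z sol1 sol2
    by (intro complex_derivative_transform_within_open[of _ "ball 0 r"])
      (auto simp: is_solution_on_def)
  then have "c1 z * (1 + (s1 z)\<^sup>2) = c2 z * (1 + (s1 z)\<^sup>2)"
    using sol1 sol2 z eq[OF z] by (simp add: is_solution_on_def)
  moreover have "1 + (s1 z)\<^sup>2 \<noteq> 0"
    using is_solution_on_first_integral[OF sol1 _ _ _ z] r by auto
  ultimately show ?thesis using eq[OF z] by simp
qed

text \<open>
  The inverse \<open>s\<close> of the lemniscatic integral satisfies \<open>s' = q\<close> with \<open>q = csqrt (1 - s ^ 4)\<close>, so
  the first equation forces \<open>c = q / (1 + s\<^sup>2)\<close>. The second equation holds because
  \<open>q' = - 2 * s ^ 3\<close> is again polynomial in \<open>s\<close>.
\<close>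

lemma is_solution_on_exists: "\<exists>s c. is_solution_on (ball 0 (1 / sqrt 2)) s c"
proof -
  obtain F where F0: "F 0 = 0"
    and F: "\<And>z. z \<in> ball 0 1 \<Longrightarrow> (F has_field_derivative 1 / csqrt (1 - z ^ 4)) (at z)"
    and inj: "inj_on F (ball 0 1)"
    and cover: "ball 0 (1 / sqrt 2) \<subseteq> F ` ball 0 1"
    using lemniscatic_integral by blast
  have "F holomorphic_on ball 0 1" unfolding holomorphic_on_open[OF open_ball] using F by blast
  from holomorphic_has_inverse[OF this open_ball inj]
  obtain s where s: "s holomorphic_on F ` ball 0 1"
    "\<And>w. w \<in> ball 0 1 \<Longrightarrow> deriv F w * deriv s (F w) = 1"
    "\<And>w. w \<in> ball 0 1 \<Longrightarrow> s (F w) = w"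
    by blast
  let ?U = "ball 0 (1 / sqrt 2) :: complex set"
  define q where "q = (\<lambda>z. csqrt (1 - s z ^ 4))"
  define c where "c = (\<lambda>z. q z / (1 + (s z)\<^sup>2))"
  have hol: "s holomorphic_on ?U" using s(1) cover holomorphic_on_subset by blast
  have s1: "s z \<in> ball 0 1" if "z \<in> ?U" for z
    using that cover s(3) by (metis (no_types, lifting) imageE subsetD)
  have nz: "1 + (s z)\<^sup>2 \<noteq> 0" if "z \<in> ?U" for z
  proof
    assume "1 + (s z)\<^sup>2 = 0"
    then have "cmod (s z) ^ 2 = 1"
      by (metis add.commute add_eq_0_iff norm_minus_cancel norm_one norm_power)
    moreover have "(cmod (s z))\<^sup>2 < 1" using s1[OF that] by (simp add: power_less_one_iff)
    ultimately show False by simp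
  qed
  have q0: "q z \<noteq> 0" if "z \<in> ?U" for z
    using one_minus_pow4_right_half_plane(3)[OF s1[OF that]] unfolding q_def by force
  have ds: "(s has_field_derivative q z) (at z)" if z: "z \<in> ?U" for z
  proof -
    obtain w where w: "w \<in> ball 0 1" "z = F w" using z cover by blast
    have "1 / csqrt (1 - w ^ 4) * deriv s z = 1"
      using s(2)[OF w(1)] DERIV_imp_deriv[OF F[OF w(1)]] w(2) by simp
    then have "deriv s z = q z"
      unfolding q_def using s(3)[OF w(1)] w(2) by (auto simp: divide_simps split: if_splits)
    then show ?thesis using holomorphic_derivI[OF hol open_ball z, of UNIV] by simp
  qed
  have dq: "(q has_field_derivative - 2 * s z ^ 3) (at z)" if z: "z \<in> ?U" for z
  proof -
    have "((\<lambda>z. 1 - s z ^ 4) has_field_derivative - (4 * s z ^ 3 * q z)) (at z)"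
      by (auto intro!: derivative_eq_intros ds[OF z])
    from has_field_derivative_csqrt'[OF this one_minus_pow4_right_half_plane(2)[OF s1[OF z]]]
    have "(q has_field_derivative (- (4 * s z ^ 3 * q z)) / (2 * q z)) (at z)"
      unfolding q_def .
    then show ?thesis using q0[OF z] by simp
  qed
  have dc: "(c has_field_derivative - s z * (1 + (c z)\<^sup>2)) (at z)" if z: "z \<in> ?U" for z
  proof -
    let ?p = "1 + (s z)\<^sup>2"
    have "(c has_field_derivative (- 2 * s z ^ 3 * ?p - q z * (2 * s z * q z)) / (?p * ?p)) (at z)"
      unfolding c_def using nz[OF z]
      by (auto intro!: derivative_eq_intros ds[OF z] dq[OF z])
    moreover have "(- 2 * s z ^ 3 * ?p - q z * (2 * s z * q z)) / (?p * ?p) = - s z * (1 + (c z)\<^sup>2)"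
    proof -
      have scaled: "- a * (p\<^sup>2 + b\<^sup>2) / (p * p) = - a * (1 + (b / p)\<^sup>2)"
        if "p \<noteq> 0" for a b p :: complex
        using that by (simp add: field_simps power2_eq_square)
      have qq: "(q z)\<^sup>2 = 1 - s z ^ 4" by (simp add: q_def)
      have "- 2 * s z ^ 3 * ?p - q z * (2 * s z * q z) = - 2 * s z ^ 3 * ?p - 2 * s z * (q z)\<^sup>2"
        by (simp add: power2_eq_square)
      also have "\<dots> = - s z * (?p\<^sup>2 + (q z)\<^sup>2)"
        unfolding qq by algebra
      finally show ?thesis
        using scaled[OF nz[OF z]] by (simp only: c_def)
    qed
    ultimately show ?thesis by simp
  qed
  have s0: "s 0 = 0" using s(3)[of 0] F0 by simp
  have "is_solution_on ?U s c"
    unfolding is_solution_on_def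
  proof (intro conjI ballI)
    show "c holomorphic_on ?U" unfolding holomorphic_on_open[OF open_ball] using dc by blast
    show "deriv s z = c z * (1 + (s z)\<^sup>2)" if "z \<in> ?U" for z
      using DERIV_imp_deriv[OF ds[OF that]] nz[OF that] by (simp add: c_def)
    show "deriv c z = - s z * (1 + (c z)\<^sup>2)" if "z \<in> ?U" for z
      using DERIV_imp_deriv[OF dc[OF that]] .
  qed (use hol s0 in \<open>simp_all add: c_def q_def\<close>)
  then show ?thesis by blast
qed

theorem theorem3:
  fixes r :: real
  assumes "r = 2 powr (- 1 / 2)"
  shows "\<exists>s c. is_solution_on (ball 0 r) s c \<and>
           (\<forall>s' c'. is_solution_on (ball 0 r) s' c' \<longrightarrow>
              (\<forall>z\<in>ball 0 r. s' z = s z \<and> c' z = c z))"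
proof -
  have "r = 1 / sqrt 2"
    using assms by (simp add: powr_minus powr_half_sqrt divide_simps)
  then obtain s c where "is_solution_on (ball 0 r) s c"
    using is_solution_on_exists by blast
  then show ?thesis using is_solution_on_unique by blast
qed

end
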